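(* Let $f:\mathbb{R}^n\to\mathbb{R}$ be a non-convex differentiable function satisfying the $q$-coordinate Lipschitz gradient assumption with constants $L_J>0$. Then the $q$-RCCD algorithm, based on the uniform distribution, for the problem $\min\{f(x): a^\top x=b,\ e_i\le x_i\le g_i,\ i\in[n]\}$ generates a random sequence $\{x^m\}_{m\ge0}$ satisfying $$\min_{0\le k\le m}E\left[(M_q(x^k,\Gamma))^2\right]\le\frac{2n\,(f(x^0)-f^* )}{q(m+1)}\qquad\text{for all } m\ge 0,$$ where $f^*$ is the optimal value of the problem.
   Context: Setting. Let $n,q\in\mathbb{N}$ with $2\le q<n$, $[n]=\{1,\dots,n\}$, $a,e,g\in\mathbb{R}^n$ with $e\le g$ componentwise, $b\in\mathbb{R}$, and $P=\{x\in\mathbb{R}^n: a^\top x=b,\ e_i\le x_i\le g_i,\ i\in[n]\}$. Let $\mathcal{J}_q=\{J\subseteq[n]:|J|=q\}$. $\|\cdot\|$ is the Euclidean norm. $q$-coordinate Lipschitz gradient assumption. For every $J\in\mathcal{J}_q$ there is a constant $L_J>0$ (fixed throughout) such that $\|\nabla_J f(x+s_J)-\nabla_J f(x)\|\le L_J\|s_J\|$ for all $x\in\mathbb{R}^n$ and all $s_J\in\mathbb{R}^n$ whose entries outside $J$ are zero; here $\nabla_J f(x)\in\mathbb{R}^n$ has entries $\partial f(x)/\partial x_j$ for $j\in J$ and $0$ for $j\notin J$. $q$-RCCD algorithm (run without stopping). Start from some $x^0\in P$. At iteration $m=0,1,2,\dots$, draw $J_m\in\mathcal{J}_q$ uniformly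 at random, independently of the previous draws; let $u^m=(u^m_j)_{j\in J_m}$ be the unique minimizer of $\sum_{j\in J_m}\frac{\partial f(x^m)}{\partial x_j}(\bar u_j-x^m_j)+\frac{L_{J_m}}{2}\sum_{j\in J_m}(\bar u_j-x^m_j)^2$ subject to $\sum_{j\in J_m}a_j\bar u_j=\sum_{j\in J_m}a_jx^m_j$ and $e_j\le\bar u_j\le g_j$ for $j\in J_m$; let $d_{J_m}(x^m)\in\mathbb{R}^n$ have entries $u^m_j-x^m_j$ for $j\in J_m$ and $0$ otherwise; set $x^{m+1}=x^m+d_{J_m}(x^m)$. Stationarity measure. Let $\mu=\binom{n-1}{q-1}$, $\Gamma\in\mathbb{R}^n$ with $\Gamma_i=\frac1\mu\sum_{J\in\mathcal{J}_q:\,i\in J}L_J$, $D_\Gamma=\mathrm{Diag}(\Gamma)$, $\|x\|_\Gamma=(x^\top D_\Gamma x)^{1/2}$. For $x\in P$ let $S(x)=\{s\in\mathbb{R}^n: a^\top s=0,\ e\le s+x\le g\}$, let $d_{\mu\Gamma}(x)$ be the unique minimizer over $s\in S(x)$ of $\psi_{\mu\Gamma}(s;x)=f(x)+\langle\nabla f(x),s\rangle+\frac{\mu}{2}\|s\|_\Gamma^2$, and $M_q(x,\Gamma)=\|d_{\mu\Gamma}(x)\|_\Gamma$. The expectation $E$ is over the random index sets drawn by the algorithm. *)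

theory Defs
  imports "HOL-Probability.Probability"
begin

text \<open>
  The dimension \<open>n\<close> is \<open>CARD('n)\<close> and the coordinate set \<open>[n]\<close> is the finite index type \<open>'n\<close>.
\<close>

definition index_sets :: "nat \<Rightarrow> 'n::finite set set" where
  "index_sets q = {J. card J = q}"

definition feasible ::
  "real^'n \<Rightarrow> real \<Rightarrow> real^'n \<Rightarrow> real^'n \<Rightarrow> (real^'n) set" where
  "feasible a b e g = {x. a \<bullet> x = b \<and> (\<forall>i. e $ i \<le> x $ i \<and> x $ i \<le> g $ i)}"

definition partial_deriv :: "(real^'n \<Rightarrow> real) \<Rightarrow> 'n \<Rightarrow> real^'n \<Rightarrow> real" where
  "partial_deriv f j x = deriv (\<lambda>t. f (x + t *\<^sub>R axis j 1)) 0"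

definition grad :: "(real^'n \<Rightarrow> real) \<Rightarrow> real^'n \<Rightarrow> real^'n" where
  "grad f x = (\<chi> j. partial_deriv f j x)"

definition grad_on :: "(real^'n \<Rightarrow> real) \<Rightarrow> 'n set \<Rightarrow> real^'n \<Rightarrow> real^'n" where
  "grad_on f J x = (\<chi> j. if j \<in> J then partial_deriv f j x else 0)"

definition coord_lipschitz_grad ::
  "nat \<Rightarrow> (real^'n \<Rightarrow> real) \<Rightarrow> ('n set \<Rightarrow> real) \<Rightarrow> bool" where
  "coord_lipschitz_grad q f L \<longleftrightarrow>
     (\<forall>J\<in>index_sets q. 0 < L J \<and>
        (\<forall>x s. (\<forall>j. j \<notin> J \<longrightarrow> s $ j = 0) \<longrightarrow>
           norm (grad_on f J (x + s) - grad_on f J x) \<le> L J * norm s))"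

text \<open>
  A family \<open>(u\<^sub>j)\<close> indexed by \<open>J\<close> is a function that is \<open>undefined\<close> outside \<open>J\<close>
  (hence \<open>\<Pi>\<^sub>E\<close>), so that the minimizer below is unique as a HOL function.
\<close>

definition subproblem_feasible ::
  "real^'n \<Rightarrow> real^'n \<Rightarrow> real^'n \<Rightarrow> 'n set \<Rightarrow> real^'n \<Rightarrow> ('n \<Rightarrow> real) set" where
  "subproblem_feasible a e g J x =
     {u \<in> (\<Pi>\<^sub>E j\<in>J. {e $ j .. g $ j}). (\<Sum>j\<in>J. a $ j * u j) = (\<Sum>j\<in>J. a $ j * x $ j)}"

definition subproblem_objective ::
  "(real^'n \<Rightarrow> real) \<Rightarrow> ('n set \<Rightarrow> real) \<Rightarrow> 'n set \<Rightarrow> real^'n \<Rightarrow> ('n \<Rightarrow> real) \<Rightarrow> real" where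
  "subproblem_objective f L J x u =
     (\<Sum>j\<in>J. partial_deriv f j x * (u j - x $ j)) + L J / 2 * (\<Sum>j\<in>J. (u j - x $ j)\<^sup>2)"

definition subproblem_min ::
  "(real^'n \<Rightarrow> real) \<Rightarrow> ('n set \<Rightarrow> real) \<Rightarrow> real^'n \<Rightarrow> real^'n \<Rightarrow> real^'n \<Rightarrow>
   'n set \<Rightarrow> real^'n \<Rightarrow> 'n \<Rightarrow> real" where
  "subproblem_min f L a e g J x =
     (THE u. is_arg_min (subproblem_objective f L J x) (\<lambda>u. u \<in> subproblem_feasible a e g J x) u)"

definition direction ::
  "(real^'n \<Rightarrow> real) \<Rightarrow> ('n set \<Rightarrow> real) \<Rightarrow> real^'n \<Rightarrow> real^'n \<Rightarrow> real^'n \<Rightarrow>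
   'n set \<Rightarrow> real^'n \<Rightarrow> real^'n" where
  "direction f L a e g J x =
     (\<chi> j. if j \<in> J then subproblem_min f L a e g J x j - x $ j else 0)"

text \<open>
  Deterministic in the sequence \<open>Js\<close>; the random sequence is obtained by inserting
  the realizations of independent uniform index sets for \<open>Js\<close>.
\<close>

primrec rccd ::
  "(real^'n \<Rightarrow> real) \<Rightarrow> ('n set \<Rightarrow> real) \<Rightarrow> real^'n \<Rightarrow> real^'n \<Rightarrow> real^'n \<Rightarrow>
   real^'n \<Rightarrow> (nat \<Rightarrow> 'n set) \<Rightarrow> nat \<Rightarrow> real^'n" where
  "rccd f L a e g x0 Js 0 = x0"
| "rccd f L a e g x0 Js (Suc m) =
     rccd f L a e g x0 Js m + direction f L a e g (Js m) (rccd f L a e g x0 Js m)"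

definition diag_mat :: "real^'n \<Rightarrow> real^'n^'n" where
  "diag_mat d = (\<chi> i j. if i = j then d $ i else 0)"

definition weighted_norm :: "real^'n \<Rightarrow> real^'n \<Rightarrow> real" where
  "weighted_norm G x = sqrt (x \<bullet> (diag_mat G *v x))"

definition mu :: "nat \<Rightarrow> nat \<Rightarrow> real" where
  "mu n q = real ((n - 1) choose (q - 1))"

definition Gamma_vec :: "nat \<Rightarrow> ('n set \<Rightarrow> real) \<Rightarrow> real^'n::finite" where
  "Gamma_vec q L = (\<chi> i. 1 / mu CARD('n) q * (\<Sum>J | J \<in> index_sets q \<and> i \<in> J. L J))"

definition feasible_steps ::
  "real^'n \<Rightarrow> real^'n \<Rightarrow> real^'n \<Rightarrow> real^'n \<Rightarrow> (real^'n) set" where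
  "feasible_steps a e g x =
     {s. a \<bullet> s = 0 \<and> (\<forall>i. e $ i \<le> (s + x) $ i \<and> (s + x) $ i \<le> g $ i)}"

definition psi ::
  "(real^'n \<Rightarrow> real) \<Rightarrow> real \<Rightarrow> real^'n \<Rightarrow> real^'n \<Rightarrow> real^'n \<Rightarrow> real" where
  "psi f c G x s = f x + grad f x \<bullet> s + c / 2 * (weighted_norm G s)\<^sup>2"

definition full_direction ::
  "(real^'n \<Rightarrow> real) \<Rightarrow> real^'n \<Rightarrow> real^'n \<Rightarrow> real^'n \<Rightarrow> real \<Rightarrow> real^'n \<Rightarrow>
   real^'n \<Rightarrow> real^'n" where
  "full_direction f a e g c G x =
     (THE s. is_arg_min (psi f c G x) (\<lambda>s. s \<in> feasible_steps a e g x) s)"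

definition stationarity ::
  "(real^'n \<Rightarrow> real) \<Rightarrow> real^'n \<Rightarrow> real^'n \<Rightarrow> real^'n \<Rightarrow> nat \<Rightarrow> real^'n \<Rightarrow>
   real^'n::finite \<Rightarrow> real" where
  "stationarity f a e g q G x = weighted_norm G (full_direction f a e g (mu CARD('n) q) G x)"

definition optimal_value :: "(real^'n \<Rightarrow> real) \<Rightarrow> (real^'n) set \<Rightarrow> real" where
  "optimal_value f P = (INF x\<in>P. f x)"

end

theory Submission imports Defs begin

text \<open>
  In one iteration from a feasible point \<open>x\<close>, the block-wise descent lemma shows that a block step
  decreases \<open>f\<close> by at least as much as its quadratic model predicts. The predicted decrease is
  compared with that of the full step \<open>d\<close>, which minimizes the model with weights \<open>\<mu> \<Gamma>\<close>.

  The key is a conformal decomposition (\<open>conformal_decomposition\<close>): as \<open>a \<bullet> d = 0\<close>, the vector \<open>d\<close> is a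
  sum of vectors with at most two nonzero entries that satisfy the same equation, agree in sign
  with \<open>d\<close> and do not exceed it. Because \<open>q \<ge> 2\<close>, they can be distributed over the blocks of
  size \<open>q\<close>, which writes \<open>d\<close> as a sum of feasible block steps. The weights \<open>\<Gamma>\<close> are made such
  that the block models of these parts sum to at most the full model at \<open>d\<close>. Minimality in the blocks and
  strong convexity of the full model then show that the block decreases, summed over all blocks,
  are at least \<open>\<mu>/2\<close> times the squared stationarity measure (\<open>sum_block_decrease\<close>).

  The block drawn in an iteration is uniform and independent of the current point
  (\<open>expectation_fresh_index\<close>), so the expected decrease is that sum divided by the number
  of blocks, and \<open>\<mu> / (n choose q) = q / n\<close>. Summing the decreases over the iterations telescopes
  and is bounded by \<open>f x\<^sub>0\<close> minus the optimal value; the minimum of the expectations is at most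
  their average.
\<close>

section \<open>Separable quadratic models over convex sets\<close>

text \<open>
  Both models that occur here, the one of a block step and the one of the full step, are
  separable quadratics. A common notion lets one existence and uniqueness argument serve both.
\<close>

definition quad_model :: "real^'n \<Rightarrow> real^'n \<Rightarrow> real^'n \<Rightarrow> real" where
  "quad_model c w s = c \<bullet> s + (\<Sum>i\<in>UNIV. w $ i * (s $ i)\<^sup>2) / 2"

lemma norm_power2_vec: "(norm (s :: real^'n))\<^sup>2 = (\<Sum>i\<in>UNIV. (s $ i)\<^sup>2)"
  by (simp add: norm_vec_def L2_set_def sum_nonneg)

lemma quad_model_const_weights:
  "quad_model c (\<chi> i. K) s = c \<bullet> s + K / 2 * (norm s)\<^sup>2"
  by (simp add: quad_model_def norm_power2_vec flip: sum_distrib_left)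

lemma quad_model_along_segment:
  "quad_model c w (d + t *\<^sub>R v) =
     quad_model c w d + t * (c \<bullet> v + (\<Sum>i\<in>UNIV. w $ i * (d $ i * v $ i)))
       + t\<^sup>2 * ((\<Sum>i\<in>UNIV. w $ i * (v $ i)\<^sup>2) / 2)"
proof -
  have "(\<Sum>i\<in>UNIV. w $ i * ((d + t *\<^sub>R v) $ i)\<^sup>2) =
     (\<Sum>i\<in>UNIV. w $ i * (d $ i)\<^sup>2 + (2 * t) * (w $ i * (d $ i * v $ i)) + t\<^sup>2 * (w $ i * (v $ i)\<^sup>2))"
    by (rule sum.cong) (simp_all add: power2_eq_square algebra_simps)
  also have "\<dots> = (\<Sum>i\<in>UNIV. w $ i * (d $ i)\<^sup>2)
      + (2 * t) * (\<Sum>i\<in>UNIV. w $ i * (d $ i * v $ i)) + t\<^sup>2 * (\<Sum>i\<in>UNIV. w $ i * (v $ i)\<^sup>2)"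
    by (simp only: sum.distrib sum_distrib_left)
  finally show ?thesis
    unfolding quad_model_def by (simp add: inner_add_right algebra_simps add_divide_distrib)
qed

text \<open>
  Along the segment from the minimizer \<open>d\<close> to \<open>s\<close> the model is \<open>t A + t\<^sup>2 B\<close> above its
  minimum; dividing by \<open>t\<close> and letting \<open>t\<close> tend to \<open>0\<close> gives \<open>A \<ge> 0\<close>, so at
  \<open>t = 1\<close> at least the quadratic part \<open>B\<close> remains. This growth gives uniqueness
  of minimizers, and with \<open>s = 0\<close> it bounds the model decrease by the squared step length.
\<close>

lemma quad_model_growth_at_minimum:
  assumes conv: "convex S" and d: "d \<in> S" and s: "s \<in> S"
    and min: "\<And>y. y \<in> S \<Longrightarrow> quad_model c w d \<le> quad_model c w y"
  shows "quad_model c w d + (\<Sum>i\<in>UNIV. w $ i * ((s - d) $ i)\<^sup>2) / 2 \<le> quad_model c w s"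
proof -
  define B where "B = (\<Sum>i\<in>UNIV. w $ i * ((s - d) $ i)\<^sup>2) / 2"
  define A where "A = c \<bullet> (s - d) + (\<Sum>i\<in>UNIV. w $ i * (d $ i * (s - d) $ i))"
  have "0 \<le> A + t * B" if "t \<in> {0<..<1}" for t
  proof -
    have "(1 - t) *\<^sub>R d + t *\<^sub>R s \<in> S"
      using conv d s that by (intro convexD) auto
    then have "d + t *\<^sub>R (s - d) \<in> S"
      by (simp add: algebra_simps)
    from min[OF this] have "0 \<le> t * (A + t * B)"
      unfolding quad_model_along_segment A_def B_def by (simp add: algebra_simps power2_eq_square)
    with that show ?thesis
      by (simp add: zero_le_mult_iff)
  qed
  then have ev: "\<forall>\<^sub>F t in at_right 0. 0 \<le> A + t * B"
    by (auto simp: eventually_at_right_field intro!: exI[of _ 1])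
  have "((\<lambda>t. A + t * B) \<longlongrightarrow> A + 0 * B) (at_right 0)"
    by (intro tendsto_intros)
  then have "0 \<le> A + 0 * B"
    by (rule tendsto_lowerbound[OF _ ev]) simp
  moreover have "quad_model c w s = quad_model c w d + A + B"
    using quad_model_along_segment[of c w d 1 "s - d"] by (simp add: A_def B_def)
  ultimately show ?thesis
    by (simp add: B_def)
qed

lemma quad_model_unique_minimum:
  fixes S :: "(real^'n) set"
  assumes comp: "compact S" and conv: "convex S" and ne: "S \<noteq> {}" and w: "\<And>i. 0 < w $ i"
  shows "\<exists>!d. d \<in> S \<and> (\<forall>y\<in>S. quad_model c w d \<le> quad_model c w y)"
proof -
  have "continuous_on S (quad_model c w)"
    unfolding quad_model_def by (intro continuous_intros) auto
  from continuous_attains_inf[OF comp ne this]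
  obtain d where d: "d \<in> S" "\<forall>y\<in>S. quad_model c w d \<le> quad_model c w y" by blast
  show ?thesis
  proof (rule ex1I)
    fix d' assume d': "d' \<in> S \<and> (\<forall>y\<in>S. quad_model c w d' \<le> quad_model c w y)"
    have "quad_model c w d + (\<Sum>i\<in>UNIV. w $ i * ((d' - d) $ i)\<^sup>2) / 2 \<le> quad_model c w d'"
      using conv d d' by (intro quad_model_growth_at_minimum) auto
    moreover have "quad_model c w d' \<le> quad_model c w d"
      using d d' by blast
    moreover have nn: "\<forall>i\<in>UNIV. 0 \<le> w $ i * ((d' - d) $ i)\<^sup>2"
      using w by (simp add: less_imp_le)
    moreover have "0 \<le> (\<Sum>i\<in>UNIV. w $ i * ((d' - d) $ i)\<^sup>2)"
      using nn by (intro sum_nonneg) auto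
    ultimately have "(\<Sum>i\<in>UNIV. w $ i * ((d' - d) $ i)\<^sup>2) = 0" by linarith
    then have "\<forall>i\<in>UNIV. w $ i * ((d' - d) $ i)\<^sup>2 = 0"
      using nn by (subst (asm) sum_nonneg_eq_0_iff) auto
    then have "\<forall>i. (d' - d) $ i = 0"
      using w by (metis UNIV_I less_irrefl mult_eq_0_iff power_eq_0_iff)
    then show "d' = d" by (simp add: vec_eq_iff)
  qed (use d in blast)
qed

section \<open>Feasible points and feasible steps\<close>

lemma feasible_conv_box: "feasible a b e g = cbox e g \<inter> {x. a \<bullet> x = b}"
  by (auto simp: feasible_def mem_box_cart)

lemma feasible_steps_conv_box: "feasible_steps a e g x = cbox (e - x) (g - x) \<inter> {s. a \<bullet> s = 0}"
  by (auto simp: feasible_steps_def mem_box_cart algebra_simps)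

lemma compact_feasible: "compact (feasible a b e g)"
  unfolding feasible_conv_box by (intro compact_Int_closed compact_cbox closed_hyperplane)

lemma compact_feasible_steps: "compact (feasible_steps a e g x)"
  unfolding feasible_steps_conv_box by (intro compact_Int_closed compact_cbox closed_hyperplane)

lemma convex_feasible_steps: "convex (feasible_steps a e g x)"
  unfolding feasible_steps_conv_box by (intro convex_Int convex_box convex_hyperplane)

lemma zero_in_feasible_steps: "x \<in> feasible a b e g \<Longrightarrow> 0 \<in> feasible_steps a e g x"
  by (simp add: feasible_def feasible_steps_def)

lemma feasible_add_step:
  "x \<in> feasible a b e g \<Longrightarrow> s \<in> feasible_steps a e g x \<Longrightarrow> x + s \<in> feasible a b e g"
  by (auto simp: feasible_def feasible_steps_def inner_add_right algebra_simps)

section \<open>The block subproblem and the full model\<close>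

text \<open>
  The subproblem for \<open>J\<close> is posed over extensional families on \<open>J\<close>; the set below consists of the
  same candidates, written as displacement vectors, which can be compared
  with vectors of the full space and across different blocks.
\<close>

definition block_steps :: "real^'n \<Rightarrow> real^'n \<Rightarrow> real^'n \<Rightarrow> 'n set \<Rightarrow> real^'n \<Rightarrow> (real^'n) set" where
  "block_steps a e g J x = feasible_steps a e g x \<inter> {s. \<forall>j. j \<notin> J \<longrightarrow> s $ j = 0}"

lemma subspace_supported: "subspace {s :: real^'n. \<forall>j. j \<notin> J \<longrightarrow> s $ j = 0}"
  by (auto simp: subspace_def)

lemma block_minimum_unique:
  assumes x: "x \<in> feasible a b e g" and L: "0 < K"
  shows "\<exists>!d. d \<in> block_steps a e g J x \<and>
    (\<forall>y\<in>block_steps a e g J x. quad_model c (\<chi> i. K) d \<le> quad_model c (\<chi> i. K) y)"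
proof (rule quad_model_unique_minimum)
  show "compact (block_steps a e g J x)"
    unfolding block_steps_def
    by (intro compact_Int_closed compact_feasible_steps closed_subspace subspace_supported)
  show "convex (block_steps a e g J x)"
    unfolding block_steps_def
    by (intro convex_Int convex_feasible_steps subspace_imp_convex subspace_supported)
  show "block_steps a e g J x \<noteq> {}"
    using zero_in_feasible_steps[OF x] by (auto simp: block_steps_def)
qed (use L in simp)

definition block_step :: "'n set \<Rightarrow> real^'n \<Rightarrow> ('n \<Rightarrow> real) \<Rightarrow> real^'n" where
  "block_step J x u = (\<chi> j. if j \<in> J then u j - x $ j else 0)"

lemma sum_if_mem:
  fixes J :: "'n::finite set" and h :: "'n \<Rightarrow> real"
  shows "(\<Sum>j\<in>UNIV. if j \<in> J then h j else 0) = sum h J"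
  by (simp add: sum.If_cases)

lemma subproblem_objective_eq_quad_model:
  "subproblem_objective f L J x u = quad_model (grad f x) (\<chi> i. L J) (block_step J x u)"
proof -
  have "grad f x \<bullet> block_step J x u = (\<Sum>j\<in>UNIV. if j \<in> J then partial_deriv f j x * (u j - x $ j) else 0)"
    by (auto simp: inner_vec_def grad_def block_step_def intro!: sum.cong)
  moreover have "(norm (block_step J x u))\<^sup>2 = (\<Sum>i\<in>UNIV. if i \<in> J then (u i - x $ i)\<^sup>2 else 0)"
    unfolding norm_power2_vec by (auto simp: block_step_def intro!: sum.cong)
  ultimately show ?thesis
    by (simp add: sum_if_mem quad_model_const_weights subproblem_objective_def)
qed

lemma block_step_feasible_iff:
  assumes x: "x \<in> feasible a b e g"
  shows "u \<in> subproblem_feasible a e g J x \<longleftrightarrow>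
    u \<in> extensional J \<and> block_step J x u \<in> block_steps a e g J x"
proof -
  have "a \<bullet> block_step J x u = (\<Sum>j\<in>UNIV. if j \<in> J then a $ j * u j - a $ j * x $ j else 0)"
    by (auto simp: inner_vec_def block_step_def algebra_simps intro!: sum.cong)
  then have "a \<bullet> block_step J x u = (\<Sum>j\<in>J. a $ j * u j) - (\<Sum>j\<in>J. a $ j * x $ j)"
    by (simp add: sum_if_mem sum_subtractf)
  then show ?thesis
    using x unfolding subproblem_feasible_def block_steps_def feasible_steps_def feasible_def
    by (auto simp: block_step_def PiE_def Pi_def)
qed

lemma block_step_inj:
  assumes "u \<in> extensional J" "v \<in> extensional J" "block_step J x u = block_step J x v"
  shows "u = v"
proof (rule extensionalityI[OF assms(1,2)])
  fix j assume "j \<in> J"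
  then show "u j = v j"
    using arg_cong[OF assms(3), of "\<lambda>s. s $ j"] by (simp add: block_step_def)
qed

text \<open>
  The map \<open>block_step\<close> is a bijection between the feasible families of the subproblem and the block
  steps, and it preserves the objective. So the unique minimizer of the model over the block
  steps shows that the description operator in \<open>subproblem_min\<close> denotes the minimizer.
\<close>

lemma direction_minimizes_model:
  fixes x :: "real^'n"
  assumes x: "x \<in> feasible a b e g" and L: "0 < L J"
  shows "direction f L a e g J x \<in> block_steps a e g J x"
    and "s \<in> block_steps a e g J x \<Longrightarrow>
      quad_model (grad f x) (\<chi> i. L J) (direction f L a e g J x) \<le> quad_model (grad f x) (\<chi> i. L J) s"
proof -
  let ?Q = "quad_model (grad f x) (\<chi> i. L J)"
  let ?F = "\<lambda>u. u \<in> subproblem_feasible a e g J x"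
  let ?u = "\<lambda>s. restrict (\<lambda>j. x $ j + s $ j) J"
  have step: "block_step J x (?u s) = s" if "s \<in> block_steps a e g J x" for s
    using that by (auto simp: block_step_def block_steps_def vec_eq_iff)
  have feas: "?F (?u s)" if "s \<in> block_steps a e g J x" for s
    using that step[OF that] by (simp add: block_step_feasible_iff[OF x])
  have arg_min_iff: "is_arg_min (subproblem_objective f L J x) ?F u \<longleftrightarrow>
      u \<in> extensional J \<and> block_step J x u \<in> block_steps a e g J x \<and>
      (\<forall>s\<in>block_steps a e g J x. ?Q (block_step J x u) \<le> ?Q s)"
    (is "_ \<longleftrightarrow> ?R") for u
  proof
    assume u: "is_arg_min (subproblem_objective f L J x) ?F u"
    have "?Q (block_step J x u) \<le> ?Q s" if "s \<in> block_steps a e g J x" for s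
      using u feas[OF that] step[OF that]
      by (auto simp: is_arg_min_linorder subproblem_objective_eq_quad_model dest!: spec[of _ "?u s"])
    with u show ?R
      by (simp add: is_arg_min_linorder block_step_feasible_iff[OF x])
  next
    assume ?R
    then show "is_arg_min (subproblem_objective f L J x) ?F u"
      by (simp add: is_arg_min_linorder subproblem_objective_eq_quad_model block_step_feasible_iff[OF x])
  qed
  have unique: "\<exists>!d. d \<in> block_steps a e g J x \<and> (\<forall>y\<in>block_steps a e g J x. ?Q d \<le> ?Q y)"
    using block_minimum_unique[OF x L] .
  then obtain d where d: "d \<in> block_steps a e g J x" "\<forall>y\<in>block_steps a e g J x. ?Q d \<le> ?Q y"
    by blast
  have "\<exists>!u. is_arg_min (subproblem_objective f L J x) ?F u"
  proof (rule ex1I[of _ "?u d"])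
    show "is_arg_min (subproblem_objective f L J x) ?F (?u d)"
      unfolding arg_min_iff using d step[OF d(1)] by simp
  next
    fix v assume "is_arg_min (subproblem_objective f L J x) ?F v"
    then have v: "v \<in> extensional J" "block_step J x v \<in> block_steps a e g J x"
      "\<forall>s\<in>block_steps a e g J x. ?Q (block_step J x v) \<le> ?Q s"
      unfolding arg_min_iff by auto
    have "block_step J x v = d" using unique v d by blast
    then show "v = ?u d"
      by (intro block_step_inj[of v J _ x]) (use v step[OF d(1)] in auto)
  qed
  from theI'[OF this]
  have "is_arg_min (subproblem_objective f L J x) ?F (subproblem_min f L a e g J x)"
    by (simp add: subproblem_min_def)
  moreover have "direction f L a e g J x = block_step J x (subproblem_min f L a e g J x)"
    by (simp add: direction_def block_step_def)
  ultimately show "direction f L a e g J x \<in> block_steps a e g J x"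
    and "s \<in> block_steps a e g J x \<Longrightarrow> ?Q (direction f L a e g J x) \<le> ?Q s"
    unfolding arg_min_iff by auto
qed

lemma weighted_norm_power2:
  assumes "\<And>i. 0 \<le> w $ i"
  shows "(weighted_norm w s)\<^sup>2 = (\<Sum>i\<in>UNIV. w $ i * (s $ i)\<^sup>2)"
proof -
  have "(diag_mat w *v s) $ i = w $ i * s $ i" for i
    by (simp add: matrix_vector_mult_def diag_mat_def if_distrib[of "\<lambda>c. c * _"] cong: if_cong)
  then have "s \<bullet> (diag_mat w *v s) = (\<Sum>i\<in>UNIV. w $ i * (s $ i)\<^sup>2)"
    by (simp add: inner_vec_def power2_eq_square algebra_simps)
  moreover have "0 \<le> (\<Sum>i\<in>UNIV. w $ i * (s $ i)\<^sup>2)"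
    using assms by (intro sum_nonneg) auto
  ultimately show ?thesis by (simp add: weighted_norm_def)
qed

lemma psi_eq_quad_model:
  assumes "\<And>i. 0 \<le> G $ i"
  shows "psi f c G x s = f x + quad_model (grad f x) (c *\<^sub>R G) s"
  by (simp add: psi_def quad_model_def weighted_norm_power2[OF assms] sum_distrib_left[symmetric] mult.assoc)

text \<open>
  The zero step is feasible and has model value \<open>0\<close>, so the growth of the model away from its
  minimizer is paid for by a negative model value at the minimizer.
\<close>

lemma full_direction_decrease:
  fixes f :: "real^'n \<Rightarrow> real" and a e g G x :: "real^'n" and c :: real
  assumes x: "x \<in> feasible a b e g" and c: "0 < c" and G: "\<And>i. 0 < G $ i"
  defines "d \<equiv> full_direction f a e g c G x"
  shows "d \<in> feasible_steps a e g x"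
    and "quad_model (grad f x) (c *\<^sub>R G) d \<le> - (c / 2 * (weighted_norm G d)\<^sup>2)"
proof -
  let ?Q = "quad_model (grad f x) (c *\<^sub>R G)"
  have G0: "\<And>i. 0 \<le> G $ i" using G less_imp_le by blast
  have zero: "0 \<in> feasible_steps a e g x" using zero_in_feasible_steps[OF x] .
  have "\<exists>!d. d \<in> feasible_steps a e g x \<and> (\<forall>y\<in>feasible_steps a e g x. ?Q d \<le> ?Q y)"
    using zero c G
    by (intro quad_model_unique_minimum compact_feasible_steps convex_feasible_steps) auto
  then have "\<exists>!d. is_arg_min (psi f c G x) (\<lambda>s. s \<in> feasible_steps a e g x) d"
    by (simp add: is_arg_min_linorder psi_eq_quad_model[OF G0] Ball_def)
  from theI'[OF this] have *: "d \<in> feasible_steps a e g x" "\<forall>y\<in>feasible_steps a e g x. ?Q d \<le> ?Q y"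
    by (auto simp: d_def full_direction_def is_arg_min_linorder psi_eq_quad_model[OF G0])
  then show "d \<in> feasible_steps a e g x" by simp
  have "?Q d + (\<Sum>i\<in>UNIV. (c *\<^sub>R G) $ i * ((0 - d) $ i)\<^sup>2) / 2 \<le> ?Q 0"
    using * zero by (intro quad_model_growth_at_minimum[OF convex_feasible_steps]) auto
  then show "?Q d \<le> - (c / 2 * (weighted_norm G d)\<^sup>2)"
    by (simp add: weighted_norm_power2[OF G0] quad_model_def sum_distrib_left[symmetric] mult.assoc)
qed

section \<open>Descent along a block\<close>

text \<open>
  The definition of \<open>grad\<close> only collects partial derivatives; differentiability is what makes
  it represent the total derivative.
\<close>

lemma has_derivative_inner_grad:
  assumes "f differentiable (at x)"
  shows "(f has_derivative (\<lambda>v. grad f x \<bullet> v)) (at x)"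
proof -
  from assms obtain f' where f': "(f has_derivative f') (at x)"
    by (auto simp: differentiable_def)
  then interpret f': linear f' by (rule has_derivative_linear)
  have partial: "partial_deriv f j x = f' (axis j 1)" for j
  proof -
    have g: "((\<lambda>t::real. x + t *\<^sub>R axis j 1) has_derivative (\<lambda>t. t *\<^sub>R axis j 1)) (at 0)"
      by (auto intro!: derivative_eq_intros)
    have "((\<lambda>t::real. f (x + t *\<^sub>R axis j 1)) has_derivative (\<lambda>t. f' (t *\<^sub>R axis j 1))) (at 0)"
      by (rule has_derivative_compose[OF g]) (use f' in simp)
    then have "((\<lambda>t::real. f (x + t *\<^sub>R axis j 1)) has_field_derivative f' (axis j 1)) (at 0)"
      by (simp add: has_field_derivative_def f'.scaleR mult.commute[of _ "f' _"] )
    then show ?thesis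
      unfolding partial_deriv_def by (rule DERIV_imp_deriv)
  qed
  have "f' v = grad f x \<bullet> v" for v
  proof -
    have "f' v = f' (\<Sum>j\<in>UNIV. v $ j *\<^sub>R axis j 1)"
      by (simp add: basis_expansion scalar_mult_eq_scaleR[symmetric])
    also have "\<dots> = (\<Sum>j\<in>UNIV. v $ j * partial_deriv f j x)"
      by (simp add: f'.sum f'.scaleR partial)
    finally show ?thesis
      by (simp add: inner_vec_def grad_def mult.commute)
  qed
  then have "f' = (\<lambda>v. grad f x \<bullet> v)" by blast
  with f' show ?thesis by simp
qed

lemma inner_grad_on:
  assumes "\<And>j. j \<notin> J \<Longrightarrow> s $ j = 0"
  shows "grad_on f J x \<bullet> s = grad f x \<bullet> s"
  using assms by (auto simp: inner_vec_def grad_on_def grad_def intro!: sum.cong)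

text \<open>
  The descent lemma restricted to directions supported on \<open>J\<close>: the difference of the two sides
  along the segment has a nonpositive derivative, by Cauchy-Schwarz and the Lipschitz bound.
\<close>

lemma block_descent:
  fixes f :: "real^'n \<Rightarrow> real"
  assumes diff: "f differentiable_on UNIV"
    and lip: "\<And>x s. (\<And>j. j \<notin> J \<Longrightarrow> s $ j = 0) \<Longrightarrow>
      norm (grad_on f J (x + s) - grad_on f J x) \<le> K * norm s"
    and s: "\<And>j. j \<notin> J \<Longrightarrow> s $ j = 0"
  shows "f (x + s) \<le> f x + grad f x \<bullet> s + K / 2 * (norm s)\<^sup>2"
proof -
  define k where "k t = f (x + t *\<^sub>R s) - t * (grad f x \<bullet> s) - K / 2 * t\<^sup>2 * (norm s)\<^sup>2" for t
  define k' where "k' t = (grad f (x + t *\<^sub>R s) - grad f x) \<bullet> s - K * t * (norm s)\<^sup>2" for t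
  have der: "(k has_field_derivative k' t) (at t)" for t
  proof -
    have "f differentiable (at (x + t *\<^sub>R s))"
      using diff by (simp add: differentiable_on_def)
    note f' = has_derivative_inner_grad[OF this]
    have g: "((\<lambda>t::real. x + t *\<^sub>R s) has_derivative (\<lambda>t. t *\<^sub>R s)) (at t)"
      by (auto intro!: derivative_eq_intros)
    have "((\<lambda>t::real. f (x + t *\<^sub>R s)) has_derivative (\<lambda>u. grad f (x + t *\<^sub>R s) \<bullet> (u *\<^sub>R s))) (at t)"
      by (rule has_derivative_compose[OF g f'])
    then have "((\<lambda>t::real. f (x + t *\<^sub>R s)) has_field_derivative grad f (x + t *\<^sub>R s) \<bullet> s) (at t)"
      by (simp add: has_field_derivative_def mult.commute[of _ "_ \<bullet> _"])
    then show ?thesis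
      unfolding k_def k'_def
      by (auto intro!: derivative_eq_intros simp: inner_diff_left algebra_simps)
  qed
  have nonpos: "k' t \<le> 0" if "0 \<le> t" for t
  proof -
    have ts: "\<And>j. j \<notin> J \<Longrightarrow> (t *\<^sub>R s) $ j = 0" using s by simp
    have "(grad f (x + t *\<^sub>R s) - grad f x) \<bullet> s = (grad_on f J (x + t *\<^sub>R s) - grad_on f J x) \<bullet> s"
      using inner_grad_on[of J s, OF s] by (simp add: inner_diff_left)
    also have "\<dots> \<le> norm (grad_on f J (x + t *\<^sub>R s) - grad_on f J x) * norm s"
      by (rule norm_cauchy_schwarz)
    also have "\<dots> \<le> (K * norm (t *\<^sub>R s)) * norm s"
      by (intro mult_right_mono lip ts) auto
    finally show ?thesis
      using that by (simp add: k'_def power2_eq_square mult.assoc)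
  qed
  have "k 1 \<le> k 0"
    by (rule DERIV_nonpos_imp_nonincreasing[OF zero_le_one]) (use der nonpos in blast)
  then show ?thesis by (simp add: k_def)
qed

section \<open>Conformal decomposition of a feasible step\<close>

text \<open>
  A conformal part of \<open>s\<close> has no sign opposite to \<open>s\<close> and never exceeds it. Hence it is no longer
  than \<open>s\<close> in any coordinate, and it stays inside every box that contains both \<open>0\<close> and \<open>s\<close>.
\<close>

definition conformal :: "real^'n \<Rightarrow> real^'n \<Rightarrow> bool" where
  "conformal v s \<longleftrightarrow> (\<forall>i. min 0 (s $ i) \<le> v $ i \<and> v $ i \<le> max 0 (s $ i))"

text \<open>
  If \<open>s\<close> has a nonzero entry where \<open>a\<close> vanishes, that entry alone is such a vector \<open>r\<close>. Otherwise
  the terms \<open>a\<^sub>i s\<^sub>i\<close> sum to \<open>0\<close> without all being \<open>0\<close>, so there are terms of both signs; the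
  one of smaller modulus in such a pair is taken completely and balanced by a fraction of the larger one.
  Two coordinates suffice, and the support of \<open>s - r\<close> is strictly smaller.
\<close>

lemma conformal_peel:
  fixes a s :: "real^'n"
  assumes as: "a \<bullet> s = 0" and s: "s \<noteq> 0"
  obtains r i j where "a \<bullet> r = 0" "conformal r s"
    "\<And>k. k \<noteq> i \<Longrightarrow> k \<noteq> j \<Longrightarrow> r $ k = 0" "s $ i \<noteq> 0" "r $ i = s $ i"
proof (cases "\<exists>i. s $ i \<noteq> 0 \<and> a $ i = 0")
  case True
  then obtain i where i: "s $ i \<noteq> 0" "a $ i = 0" by blast
  show ?thesis
  proof (rule that[of "axis i (s $ i)" i i])
    show "a \<bullet> axis i (s $ i) = 0" using i by (simp add: inner_axis)
    show "conformal (axis i (s $ i)) s" by (auto simp: conformal_def axis_def)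
  qed (use i in \<open>auto simp: axis_def\<close>)
next
  case False
  have sum0: "(\<Sum>i\<in>UNIV. a $ i * s $ i) = 0"
    using as by (simp add: inner_vec_def)
  obtain k where "s $ k \<noteq> 0" using s by (auto simp: vec_eq_iff)
  with False have k: "a $ k * s $ k \<noteq> 0" by auto
  have ex_pos: "\<exists>i. 0 < a $ i * s $ i"
  proof (rule ccontr)
    assume "\<not> ?thesis"
    then have "\<forall>i\<in>UNIV. 0 \<le> - (a $ i * s $ i)" by (auto simp: not_less)
    then have "\<forall>i\<in>UNIV. - (a $ i * s $ i) = 0"
      using sum0 by (subst sum_nonneg_eq_0_iff[symmetric]) (auto simp: sum_negf)
    with k show False by auto
  qed
  have ex_neg: "\<exists>j. a $ j * s $ j < 0"
  proof (rule ccontr)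
    assume "\<not> ?thesis"
    then have "\<forall>i\<in>UNIV. 0 \<le> a $ i * s $ i" by (auto simp: not_less)
    then have "\<forall>i\<in>UNIV. a $ i * s $ i = 0"
      using sum0 by (subst sum_nonneg_eq_0_iff[symmetric]) auto
    with k show False by auto
  qed
  have ratio: "0 \<le> - u / v" "- u / v \<le> 1" if "u * v < 0" "\<bar>u\<bar> \<le> \<bar>v\<bar>" for u v :: real
    using that by (auto simp: divide_simps mult_less_0_iff)
  note peel = that
  have pair: thesis
    if opp: "(a $ i * s $ i) * (a $ j * s $ j) < 0" and le: "\<bar>a $ i * s $ i\<bar> \<le> \<bar>a $ j * s $ j\<bar>" for i j
  proof -
    have ij: "i \<noteq> j" using opp by (metis not_square_less_zero)
    have nz: "a $ i \<noteq> 0" "a $ j \<noteq> 0" "s $ i \<noteq> 0" "s $ j \<noteq> 0" using opp by auto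
    \<comment> \<open>the fraction of the larger term that balances the smaller one\<close>
    define c where "c = - (a $ i * s $ i) / (a $ j * s $ j)"
    have c: "0 \<le> c" "c \<le> 1"
      using ratio[OF opp le] by (simp_all add: c_def)
    have cs: "min 0 (s $ j) \<le> c * s $ j" "c * s $ j \<le> max 0 (s $ j)"
      using c mult_right_mono[of c 1 "s $ j"] mult_right_mono_neg[of c 1 "s $ j"]
      by (cases "0 \<le> s $ j"; simp add: mult_nonneg_nonpos)+
    have acs: "a $ j * (c * s $ j) = - (a $ i * s $ i)"
      using nz by (simp add: c_def)
    show thesis
    proof (rule peel[of "axis i (s $ i) + axis j (c * s $ j)" i j])
      show "a \<bullet> (axis i (s $ i) + axis j (c * s $ j)) = 0"
        using acs by (simp add: inner_add_right inner_axis)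
      show "conformal (axis i (s $ i) + axis j (c * s $ j)) s"
        using cs ij by (auto simp: conformal_def axis_def)
    qed (use ij nz in \<open>auto simp: axis_def\<close>)
  qed
  obtain i j where i: "0 < a $ i * s $ i" and j: "a $ j * s $ j < 0"
    using ex_pos ex_neg by blast
  show ?thesis
  proof (cases "\<bar>a $ i * s $ i\<bar> \<le> \<bar>a $ j * s $ j\<bar>")
    case True
    then show ?thesis using mult_pos_neg[OF i j] by (intro pair[of i j])
  next
    case False
    then show ?thesis using mult_neg_pos[OF j i] by (intro pair[of j i]) auto
  qed
qed

text \<open>
  Vectors with at most two nonzero entries are peeled off until nothing is left. Since \<open>q \<ge> 2\<close>, the
  support of each fits into some block of size \<open>q\<close>, to which the vector is added. The parts
  stay conformal because \<open>r\<close> and the parts of \<open>s - r\<close> have the sign of \<open>s\<close> and together do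
  not exceed it.
\<close>

lemma conformal_decomposition:
  fixes a s :: "real^'n"
  assumes q2: "2 \<le> q" and qn: "q \<le> CARD('n)" and as: "a \<bullet> s = 0"
  shows "\<exists>S. s = (\<Sum>A\<in>index_sets q. S A) \<and>
    (\<forall>A. a \<bullet> S A = 0 \<and> conformal (S A) s \<and> (\<forall>j. j \<notin> A \<longrightarrow> S A $ j = 0))"
  using as
proof (induction "card {i. s $ i \<noteq> 0}" arbitrary: s rule: less_induct)
  case less
  show ?case
  proof (cases "s = 0")
    case True
    then show ?thesis by (intro exI[of _ "\<lambda>_. 0"]) (auto simp: conformal_def)
  next
    case False
    then obtain r i j where r: "a \<bullet> r = 0" "conformal r s"
      "\<And>k. k \<noteq> i \<Longrightarrow> k \<noteq> j \<Longrightarrow> r $ k = 0" "s $ i \<noteq> 0" "r $ i = s $ i"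
      using conformal_peel[OF less.prems] by blast
    have r_between: "min 0 (s $ k) \<le> r $ k" "r $ k \<le> max 0 (s $ k)" for k
      using r(2) by (auto simp: conformal_def)
    have "{k. (s - r) $ k \<noteq> 0} \<subset> {k. s $ k \<noteq> 0}"
    proof (rule psubsetI)
      show "{k. (s - r) $ k \<noteq> 0} \<subseteq> {k. s $ k \<noteq> 0}"
      proof safe
        fix k assume "(s - r) $ k \<noteq> 0" "s $ k = 0"
        with r_between[of k] show False by simp
      qed
      show "{k. (s - r) $ k \<noteq> 0} \<noteq> {k. s $ k \<noteq> 0}"
        using r(4,5) by (metis (mono_tags, lifting) diff_self mem_Collect_eq vector_minus_component)
    qed
    then have "card {k. (s - r) $ k \<noteq> 0} < card {k. s $ k \<noteq> 0}"
      by (intro psubset_card_mono) auto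
    moreover have "a \<bullet> (s - r) = 0"
      using less.prems r(1) by (simp add: inner_diff_right)
    ultimately obtain S where S': "s - r = (\<Sum>A\<in>index_sets q. S A) \<and>
        (\<forall>A. a \<bullet> S A = 0 \<and> conformal (S A) (s - r) \<and> (\<forall>j. j \<notin> A \<longrightarrow> S A $ j = 0))"
      using less.hyps by blast
    have S: "s - r = (\<Sum>A\<in>index_sets q. S A)"
      "\<And>A. a \<bullet> S A = 0" "\<And>A. conformal (S A) (s - r)" "\<And>A j. j \<notin> A \<Longrightarrow> S A $ j = 0"
      using S' by blast+
    have "card {i, j} \<le> q" using q2 by (cases "i = j") auto
    then obtain B where B: "{i, j} \<subseteq> B" "card B = q"
      using exists_subset_between[of "{i,j}" q "UNIV :: 'n set"] qn by auto
    define T where "T A = (if A = B then S B + r else S A)" for A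
    have S_between: "min 0 (s $ k - r $ k) \<le> S A $ k" "S A $ k \<le> max 0 (s $ k - r $ k)" for A k
      using S(3)[of A] by (auto simp: conformal_def)
    have "(\<Sum>A\<in>index_sets q. T A) = (\<Sum>A\<in>index_sets q. S A + (if A = B then r else 0))"
      by (intro sum.cong) (auto simp: T_def)
    also have "\<dots> = s"
      using B S(1)[symmetric] by (simp add: sum.distrib) (simp add: index_sets_def)
    finally have sumT: "s = (\<Sum>A\<in>index_sets q. T A)" ..
    have "conformal (T A) s" for A
      unfolding conformal_def
    proof
      fix k
      show "min 0 (s $ k) \<le> T A $ k \<and> T A $ k \<le> max 0 (s $ k)"
        using S_between[where A = A and k = k] S_between[where A = B and k = k] r_between[of k]
        unfolding T_def by (cases "A = B"; simp; linarith)
    qed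
    moreover have "a \<bullet> T A = 0" for A
      using S(2) r(1) by (simp add: T_def inner_add_right)
    moreover have "T A $ k = 0" if "k \<notin> A" for A k
      using that S(4)[of k A] r(3)[of k] B by (cases "k = i \<or> k = j") (auto simp: T_def)
    ultimately show ?thesis using sumT by blast
  qed
qed

lemma conformal_power2_le:
  assumes "conformal v s"
  shows "(v $ i)\<^sup>2 \<le> (s $ i)\<^sup>2"
proof -
  have "min 0 (s $ i) \<le> v $ i" "v $ i \<le> max 0 (s $ i)"
    using assms by (auto simp: conformal_def)
  then have "\<bar>v $ i\<bar> \<le> \<bar>s $ i\<bar>" by linarith
  then show ?thesis by (simp add: abs_le_square_iff)
qed

lemma conformal_feasible_step:
  assumes "conformal v s" "a \<bullet> v = 0" "s \<in> feasible_steps a e g x" "x \<in> feasible a b e g"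
  shows "v \<in> feasible_steps a e g x"
  unfolding feasible_steps_def
proof (intro CollectI conjI allI)
  fix i
  have "min 0 (s $ i) \<le> v $ i" "v $ i \<le> max 0 (s $ i)"
    using assms by (auto simp: conformal_def)
  moreover have "e $ i \<le> x $ i" "x $ i \<le> g $ i" "e $ i \<le> s $ i + x $ i" "s $ i + x $ i \<le> g $ i"
    using assms(3,4) by (auto simp: feasible_def feasible_steps_def)
  ultimately show "e $ i \<le> (v + x) $ i" "(v + x) $ i \<le> g $ i"
    unfolding vector_add_component by linarith+
qed (use assms in simp)

section \<open>Decrease of one iteration over all blocks\<close>

text \<open>
  The full step \<open>d\<close> is split conformally into block steps. Each block minimizer does at least as well
  in its model as the part of \<open>d\<close> assigned to the block, and that part is no longer than \<open>d\<close>
  restricted to the block. Summed over all blocks, the linear terms add up to that of \<open>d\<close>, and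
  the quadratic terms to at most the weighted square of \<open>d\<close>: a coordinate \<open>i\<close>
  collects the weight \<open>L A\<close> from every block \<open>A\<close> containing it, in total \<open>\<mu> \<Gamma>\<^sub>i\<close>.
  So the sum of the block decreases is at least the decrease of the full model.
\<close>

lemma sum_block_decrease:
  fixes f :: "real^'n \<Rightarrow> real" and a e g x :: "real^'n" and L :: "'n set \<Rightarrow> real"
  assumes q2: "2 \<le> q" and qn: "q < CARD('n)"
    and diff: "f differentiable_on UNIV" and lip: "coord_lipschitz_grad q f L"
    and x: "x \<in> feasible a b e g"
  shows "mu CARD('n) q / 2 * (stationarity f a e g q (Gamma_vec q L) x)\<^sup>2
    \<le> (\<Sum>A\<in>index_sets q. f x - f (x + direction f L a e g A x))"
proof -
  let ?I = "index_sets q :: 'n set set"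
  define c where "c = mu CARD('n) q"
  define G where "G = (Gamma_vec q L :: real^'n)"
  define d where "d = full_direction f a e g c G x"
  have L: "0 < L A" if "A \<in> ?I" for A
    using lip that by (auto simp: coord_lipschitz_grad_def)
  have c: "0 < c"
    using q2 qn by (simp add: c_def mu_def)
  have cG: "c * G $ i = (\<Sum>A | A \<in> ?I \<and> i \<in> A. L A)" for i
    using c by (simp add: G_def Gamma_vec_def c_def)
  have G: "0 < G $ i" for i
  proof -
    obtain A where "{i} \<subseteq> A" "card A = q"
      using exists_subset_between[of "{i}" q "UNIV :: 'n set"] q2 qn by auto
    then have "{A \<in> ?I. i \<in> A} \<noteq> {}" by (auto simp: index_sets_def)
    then have "0 < c * G $ i"
      unfolding cG by (intro sum_pos) (auto intro: L)
    with c show ?thesis by (simp add: zero_less_mult_iff)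
  qed
  have d: "d \<in> feasible_steps a e g x"
    and dec: "quad_model (grad f x) (c *\<^sub>R G) d \<le> - (c / 2 * (weighted_norm G d)\<^sup>2)"
    unfolding d_def using full_direction_decrease[OF x c G] by auto
  have "a \<bullet> d = 0" using d by (simp add: feasible_steps_def)
  then obtain S where S: "d = (\<Sum>A\<in>?I. S A)" "\<And>A. a \<bullet> S A = 0" "\<And>A. conformal (S A) d"
    "\<And>A j. j \<notin> A \<Longrightarrow> S A $ j = 0"
    using conformal_decomposition[OF q2, of a d] qn by (auto simp: less_imp_le)
  have block: "f (x + direction f L a e g A x) - f x
      \<le> grad f x \<bullet> S A + L A / 2 * (\<Sum>i\<in>A. (d $ i)\<^sup>2)" if A: "A \<in> ?I" for A
  proof -
    let ?v = "direction f L a e g A x"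
    let ?Q = "quad_model (grad f x) (\<chi> i. L A)"
    have v: "?v \<in> block_steps a e g A x"
      using direction_minimizes_model(1)[OF x, of L A f] L[OF A] by simp
    have "f (x + ?v) \<le> f x + ?Q ?v"
      unfolding quad_model_const_weights add.assoc[symmetric]
    proof (rule block_descent[OF diff])
      show "?v $ j = 0" if "j \<notin> A" for j
        using v that by (simp add: block_steps_def)
      show "norm (grad_on f A (y + s) - grad_on f A y) \<le> L A * norm s"
        if "\<And>j. j \<notin> A \<Longrightarrow> s $ j = 0" for y s
        using lip A that by (auto simp: coord_lipschitz_grad_def)
    qed
    moreover have "?Q ?v \<le> ?Q (S A)"
      using S conformal_feasible_step[OF S(3) S(2) d x]
      by (intro direction_minimizes_model(2)[OF x, of L A, OF L[OF A]]) (auto simp: block_steps_def)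
    moreover have "(norm (S A))\<^sup>2 \<le> (\<Sum>i\<in>A. (d $ i)\<^sup>2)"
    proof -
      have "(norm (S A))\<^sup>2 = (\<Sum>i\<in>UNIV. (S A $ i)\<^sup>2)"
        by (rule norm_power2_vec)
      also have "\<dots> = (\<Sum>i\<in>A. (S A $ i)\<^sup>2)"
        using S(4) by (intro sum.mono_neutral_right) auto
      also have "\<dots> \<le> (\<Sum>i\<in>A. (d $ i)\<^sup>2)"
        by (intro sum_mono conformal_power2_le S(3))
      finally show ?thesis .
    qed
    then have "?Q (S A) \<le> grad f x \<bullet> S A + L A / 2 * (\<Sum>i\<in>A. (d $ i)\<^sup>2)"
      unfolding quad_model_const_weights using L[OF A] by (intro add_left_mono mult_left_mono) auto
    ultimately show ?thesis by linarith
  qed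
  have "(\<Sum>A\<in>?I. L A * (\<Sum>i\<in>A. (d $ i)\<^sup>2)) = (\<Sum>A\<in>?I. \<Sum>i\<in>A. L A * (d $ i)\<^sup>2)"
    by (simp add: sum_distrib_left)
  also have "\<dots> = (\<Sum>A\<in>?I. \<Sum>i | i \<in> UNIV \<and> i \<in> A. L A * (d $ i)\<^sup>2)"
    by simp
  also have "\<dots> = (\<Sum>i\<in>UNIV. \<Sum>A | A \<in> ?I \<and> i \<in> A. L A * (d $ i)\<^sup>2)"
    by (rule sum.swap_restrict) auto
  also have "\<dots> = (\<Sum>i\<in>UNIV. (c *\<^sub>R G) $ i * (d $ i)\<^sup>2)"
    by (simp add: cG sum_distrib_right)
  finally have swap: "(\<Sum>A\<in>?I. L A * (\<Sum>i\<in>A. (d $ i)\<^sup>2)) = (\<Sum>i\<in>UNIV. (c *\<^sub>R G) $ i * (d $ i)\<^sup>2)" .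
  have "(\<Sum>A\<in>?I. f (x + direction f L a e g A x) - f x)
      \<le> (\<Sum>A\<in>?I. grad f x \<bullet> S A + L A * (\<Sum>i\<in>A. (d $ i)\<^sup>2) / 2)"
    using block by (intro sum_mono) simp
  also have "\<dots> = grad f x \<bullet> d + (\<Sum>A\<in>?I. L A * (\<Sum>i\<in>A. (d $ i)\<^sup>2)) / 2"
    unfolding sum.distrib inner_sum_right[symmetric] S(1)[symmetric] sum_divide_distrib[symmetric] ..
  also have "\<dots> = quad_model (grad f x) (c *\<^sub>R G) d"
    unfolding swap quad_model_def ..
  also note dec
  finally have "(\<Sum>A\<in>?I. f (x + direction f L a e g A x) - f x) \<le> - (c / 2 * (weighted_norm G d)\<^sup>2)" .
  moreover have stat: "stationarity f a e g q (Gamma_vec q L) x = weighted_norm G d"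
    unfolding stationarity_def c_def G_def d_def ..
  ultimately show ?thesis
    unfolding stat c_def[symmetric] sum_subtractf by linarith
qed

section \<open>Averaging over a fresh independent index\<close>

text \<open>
  The product space is finite and its singletons are measurable, hence so is every subset.
\<close>

lemma measurable_finite_product:
  fixes \<phi> :: "('i \<Rightarrow> 'b::finite) \<Rightarrow> 'c"
  assumes fin: "finite I" and ran: "\<And>h. \<phi> h \<in> space N"
  shows "\<phi> \<in> measurable (PiM I (\<lambda>_. count_space UNIV)) N"
proof (rule measurableI)
  let ?P = "PiM I (\<lambda>_. count_space (UNIV :: 'b set))"
  fix X
  let ?A = "\<phi> -` X \<inter> space ?P"
  have "finite (space ?P)"
    using fin by (auto simp: space_PiM intro!: finite_PiE)
  then have "finite ?A" by simp
  moreover have "{h} \<in> sets ?P" if "h \<in> ?A" for h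
  proof -
    have "(\<Pi>\<^sub>E i\<in>I. {h i}) \<in> sets ?P"
      using fin by (intro sets_PiM_I_finite) auto
    moreover have "(\<Pi>\<^sub>E i\<in>I. {h i}) = {h}"
      using that by (intro PiE_singleton) (auto simp: space_PiM PiE_def)
    ultimately show ?thesis by simp
  qed
  ultimately have "(\<Union>h\<in>?A. {h}) \<in> sets ?P"
    by (intro sets.finite_UN) auto
  then show "?A \<in> sets ?P" by simp
qed (rule ran)

context prob_space
begin

text \<open>
  Invariance under \<open>restrict\<close> expresses that \<open>\<phi>\<close> only looks at the first \<open>m\<close> draws. It then takes
  finitely many values.
\<close>

lemma integrable_of_finite_history:
  fixes J :: "nat \<Rightarrow> 'a \<Rightarrow> 'b::finite" and \<phi> :: "(nat \<Rightarrow> 'b) \<Rightarrow> real"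
  assumes J: "\<And>i. J i \<in> measurable M (count_space UNIV)"
    and hist: "\<And>h. \<phi> (restrict h {..<m}) = \<phi> h"
  shows "integrable M (\<lambda>\<omega>. \<phi> (\<lambda>i. J i \<omega>))"
proof (rule integrable_const_bound)
  let ?S = "{..<m} \<rightarrow>\<^sub>E (UNIV :: 'b set)"
  have fin: "finite ?S" by (intro finite_PiE) auto
  have "(\<lambda>\<omega>. \<phi> (restrict (\<lambda>i. J i \<omega>) {..<m})) \<in> borel_measurable M"
    by (rule measurable_compose[OF measurable_restrict measurable_finite_product])
       (use J in auto)
  then show "(\<lambda>\<omega>. \<phi> (\<lambda>i. J i \<omega>)) \<in> borel_measurable M"
    by (simp add: hist)
  have "norm (\<phi> h) \<le> (\<Sum>h\<in>?S. norm (\<phi> h))" for h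
  proof -
    have "restrict h {..<m} \<in> ?S" by simp
    then have "norm (\<phi> (restrict h {..<m})) \<le> (\<Sum>h\<in>?S. norm (\<phi> h))"
      by (rule member_le_sum) (use fin in auto)
    then show ?thesis by (simp add: hist)
  qed
  then show "AE \<omega> in M. norm (\<phi> (\<lambda>i. J i \<omega>)) \<le> (\<Sum>h\<in>?S. norm (\<phi> h))"
    by simp
qed

text \<open>
  The index drawn in round \<open>m\<close> is independent of the earlier draws, hence of every quantity that
  depends on those alone. On the event that this index is \<open>A\<close> the expectation therefore
  factors, and summing over the finitely many \<open>A\<close> averages over the new draw.
\<close>

lemma expectation_fresh_index:
  fixes J :: "nat \<Rightarrow> 'a \<Rightarrow> 'b::finite" and H :: "'b \<Rightarrow> (nat \<Rightarrow> 'b) \<Rightarrow> real"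
  assumes ind: "indep_vars (\<lambda>_. count_space UNIV) J UNIV"
    and hist: "\<And>A h. H A (restrict h {..<m}) = H A h"
  shows "expectation (\<lambda>\<omega>. H (J m \<omega>) (\<lambda>i. J i \<omega>)) =
    (\<Sum>A\<in>UNIV. measure (distr M (count_space UNIV) (J m)) {A} * expectation (\<lambda>\<omega>. H A (\<lambda>i. J i \<omega>)))"
proof -
  have J: "J i \<in> measurable M (count_space UNIV)" for i
    using ind by (auto simp: indep_vars_def)
  let ?I = "\<lambda>A \<omega>. indicator {A} (J m \<omega>) :: real"
  have prod: "integrable M (\<lambda>\<omega>. ?I A \<omega> * H A (\<lambda>i. J i \<omega>)) \<and>
    expectation (\<lambda>\<omega>. ?I A \<omega> * H A (\<lambda>i. J i \<omega>)) = expectation (?I A) * expectation (\<lambda>\<omega>. H A (\<lambda>i. J i \<omega>))" for A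
  proof -
    let ?C = "\<lambda>I. PiM I (\<lambda>_::nat. count_space (UNIV :: 'b set))"
    have "indep_var (?C {m}) (\<lambda>\<omega>. restrict (\<lambda>i. J i \<omega>) {m}) (?C {..<m}) (\<lambda>\<omega>. restrict (\<lambda>i. J i \<omega>) {..<m})"
      by (rule indep_var_restrict[OF ind]) auto
    then have "indep_var borel ((\<lambda>h. indicator {A} (h m) :: real) \<circ> (\<lambda>\<omega>. restrict (\<lambda>i. J i \<omega>) {m}))
        borel (H A \<circ> (\<lambda>\<omega>. restrict (\<lambda>i. J i \<omega>) {..<m}))"
      by (rule indep_var_compose) (intro measurable_finite_product; simp)+
    then have iv: "indep_var borel (?I A) borel (\<lambda>\<omega>. H A (\<lambda>i. J i \<omega>))"
      by (simp add: o_def hist)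
    have i1: "integrable M (?I A)"
      by (rule integrable_const_bound[of _ 1])
         (auto simp: indicator_def intro!: measurable_compose[OF J])
    have i2: "integrable M (\<lambda>\<omega>. H A (\<lambda>i. J i \<omega>))"
      by (rule integrable_of_finite_history[of J "H A" m]) (use J hist in auto)
    show ?thesis
      using indep_var_integrable[OF iv i1 i2] indep_var_lebesgue_integral[OF iv i1 i2] by simp
  qed
  have pr: "expectation (?I A) = measure (distr M (count_space UNIV) (J m)) {A}" for A
  proof -
    have "expectation (?I A) = expectation (indicator (J m -` {A} \<inter> space M))"
      by (intro Bochner_Integration.integral_cong) (auto simp: indicator_def)
    then show ?thesis
      using J[of m] by (simp add: measure_distr)
  qed
  have "expectation (\<lambda>\<omega>. H (J m \<omega>) (\<lambda>i. J i \<omega>)) = expectation (\<lambda>\<omega>. \<Sum>A\<in>UNIV. ?I A \<omega> * H A (\<lambda>i. J i \<omega>))"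
    by (intro Bochner_Integration.integral_cong) (auto simp: indicator_def if_distrib[of "\<lambda>c. c * _"] cong: if_cong)
  also have "\<dots> = (\<Sum>A\<in>UNIV. expectation (\<lambda>\<omega>. ?I A \<omega> * H A (\<lambda>i. J i \<omega>)))"
    using prod by (intro Bochner_Integration.integral_sum) auto
  finally show ?thesis by (simp add: prod pr)
qed

end

section \<open>Expected convergence of the random sequence\<close>

lemma rccd_restrict: "k \<le> m \<Longrightarrow> rccd f L a e g x0 (restrict h {..<m}) k = rccd f L a e g x0 h k"
  by (induction k) auto

lemma rccd_feasible:
  fixes x0 :: "real^'n" and L :: "'n set \<Rightarrow> real"
  assumes "x0 \<in> feasible a b e g" "\<And>i. h i \<in> index_sets q" "\<And>A. A \<in> index_sets q \<Longrightarrow> 0 < L A"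
  shows "rccd f L a e g x0 h k \<in> feasible a b e g"
proof (induction k)
  case (Suc k)
  have "direction f L a e g (h k) (rccd f L a e g x0 h k) \<in> block_steps a e g (h k) (rccd f L a e g x0 h k)"
    using Suc assms by (intro direction_minimizes_model(1)) auto
  then show ?case
    using Suc by (auto simp: block_steps_def intro: feasible_add_step)
qed (use assms in simp)

lemma mu_over_card_index_sets:
  assumes "0 < q" "q \<le> CARD('n::finite)"
  shows "mu CARD('n) q / real (card (index_sets q :: 'n set set)) = real q / real CARD('n)"
proof -
  have "card (index_sets q :: 'n set set) = CARD('n) choose q"
    using n_subsets[of "UNIV :: 'n set" q] by (simp add: index_sets_def)
  moreover have "real q * real (CARD('n) choose q) = real CARD('n) * mu CARD('n) q"
    using times_binomial_minus1_eq[of q "CARD('n)"] assms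
    unfolding mu_def of_nat_mult[symmetric] by simp
  moreover have "CARD('n) choose q > 0" using assms by simp
  ultimately show ?thesis by (simp add: field_simps)
qed

lemma index_sets_nonempty:
  assumes "q \<le> CARD('n::finite)"
  shows "(index_sets q :: 'n set set) \<noteq> {}"
  using obtain_subset_with_card_n[OF assms] by (auto simp: index_sets_def)

text \<open>
  The infimum over the feasible set is a genuine lower bound because \<open>f\<close> is continuous on this
  compact set.
\<close>

lemma optimal_value_le:
  fixes f :: "real^'n \<Rightarrow> real"
  assumes "f differentiable_on UNIV" "x \<in> feasible a b e g"
  shows "optimal_value f (feasible a b e g) \<le> f x"
proof -
  have "continuous_on (feasible a b e g) f"
    using differentiable_imp_continuous_on[OF assms(1)] continuous_on_subset by blast
  then have "bdd_below (f ` feasible a b e g)"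
    using compact_feasible by (intro bounded_imp_bdd_below compact_imp_bounded compact_continuous_image)
  then show ?thesis
    unfolding optimal_value_def using assms(2) by (intro cINF_lower)
qed

theorem theorem4p11:
  fixes f :: "real^'n \<Rightarrow> real"
    and a e g x0 :: "real^'n"
    and b :: real
    and q :: nat
    and L :: "'n set \<Rightarrow> real"
    and M :: "'w measure"
    and J :: "nat \<Rightarrow> 'w \<Rightarrow> 'n set"
  assumes q_ge: "2 \<le> q"
    and q_less: "q < CARD('n)"
    and bounds: "\<And>i. e $ i \<le> g $ i"
    and diff: "f differentiable_on UNIV"
    and lip: "coord_lipschitz_grad q f L"
    and start: "x0 \<in> feasible a b e g"
    and prob: "prob_space M"
    and indep: "prob_space.indep_vars M (\<lambda>_. count_space UNIV) J UNIV"
    and unif: "\<And>m. distr M (count_space UNIV) (J m) = measure_pmf (pmf_of_set (index_sets q))"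
  shows "\<forall>m::nat.
    (MIN k\<in>{0..m}. \<integral>\<omega>. (stationarity f a e g q (Gamma_vec q L)
                              (rccd f L a e g x0 (\<lambda>i. J i \<omega>) k))\<^sup>2 \<partial>M)
      \<le> 2 * real CARD('n) * (f x0 - optimal_value f (feasible a b e g)) / (real q * (real m + 1))"
proof
  fix m :: nat
  interpret prob_space M by (rule prob)
  let ?I = "index_sets q :: 'n set set"
  let ?P = "feasible a b e g"
  define X where "X h k = rccd f L a e g x0 h k" for h k
  define N where "N x = (stationarity f a e g q (Gamma_vec q L) x)\<^sup>2" for x
  define F where "F k = expectation (\<lambda>\<omega>. f (X (\<lambda>i. J i \<omega>) k))" for k
  define E where "E k = expectation (\<lambda>\<omega>. N (X (\<lambda>i. J i \<omega>) k))" for k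
  define r where "r = real q / (2 * real CARD('n))"
  have r: "0 < r" using q_ge by (simp add: r_def)
  have L: "0 < L A" if "A \<in> ?I" for A
    using lip that by (auto simp: coord_lipschitz_grad_def)
  have I: "finite ?I" "?I \<noteq> {}"
    using index_sets_nonempty q_less by (simp, metis less_imp_le)
  have J: "J i \<in> measurable M (count_space UNIV)" for i
    using indep by (auto simp: indep_vars_def)
  have int: "integrable M (\<lambda>\<omega>. \<phi> (X (\<lambda>i. J i \<omega>) k))" for \<phi> :: "real^'n \<Rightarrow> real" and k
    by (rule integrable_of_finite_history[of J "\<lambda>h. \<phi> (X h k)" k])
       (use J in \<open>auto simp: X_def rccd_restrict\<close>)
  have AE_I: "AE \<omega> in M. J i \<omega> \<in> ?I" for i
  proof -
    have "AE A in distr M (count_space UNIV) (J i). A \<in> ?I"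
      unfolding unif using I by (simp add: AE_measure_pmf_iff)
    then show ?thesis
      using J by (subst (asm) AE_distr_iff) auto
  qed
  then have "AE \<omega> in M. \<forall>i. J i \<omega> \<in> ?I"
    by (simp add: AE_all_countable)
  \<comment> \<open>For index sets of other sizes than \<open>q\<close> nothing is known about the step, hence \<open>AE\<close>.\<close>
  then have feas: "AE \<omega> in M. \<forall>k. X (\<lambda>i. J i \<omega>) k \<in> ?P"
  proof eventually_elim
    case (elim \<omega>)
    then show ?case
      unfolding X_def by (intro allI rccd_feasible[where q = q] start L) auto
  qed
  have step: "r * E k \<le> F k - F (Suc k)" for k
  proof -
    \<comment> \<open>the decrease that block \<open>A\<close> would yield in round \<open>k\<close>; it depends on the first \<open>k\<close> draws only\<close>
    define H where "H A h = f (X h k) - f (X h k + direction f L a e g A (X h k))" for A h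
    have H_hist: "H A (restrict h {..<k}) = H A h" for A h
      by (simp add: H_def X_def rccd_restrict)
    have H_int: "integrable M (\<lambda>\<omega>. H A (\<lambda>i. J i \<omega>))" for A
      unfolding H_def by (rule int)
    have weight: "measure (distr M (count_space UNIV) (J k)) {A} = indicator ?I A / real (card ?I)" for A
      unfolding unif using I by (simp add: measure_pmf_single)
    have "F k - F (Suc k) = expectation (\<lambda>\<omega>. H (J k \<omega>) (\<lambda>i. J i \<omega>))"
      unfolding F_def
      by (subst Bochner_Integration.integral_diff[symmetric, OF int int]) (simp add: H_def X_def)
    also have "\<dots> = (\<Sum>A\<in>UNIV. indicator ?I A / real (card ?I) * expectation (\<lambda>\<omega>. H A (\<lambda>i. J i \<omega>)))"
      unfolding expectation_fresh_index[OF indep, of H k, OF H_hist] weight ..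
    also have "\<dots> = (\<Sum>A\<in>?I. expectation (\<lambda>\<omega>. H A (\<lambda>i. J i \<omega>))) / real (card ?I)"
      unfolding sum_divide_distrib by (rule sum.mono_neutral_cong_right) (auto simp: indicator_def)
    also have "(\<Sum>A\<in>?I. expectation (\<lambda>\<omega>. H A (\<lambda>i. J i \<omega>))) = expectation (\<lambda>\<omega>. \<Sum>A\<in>?I. H A (\<lambda>i. J i \<omega>))"
      by (rule Bochner_Integration.integral_sum[symmetric]) (rule H_int)
    finally have F_diff: "F k - F (Suc k) = expectation (\<lambda>\<omega>. \<Sum>A\<in>?I. H A (\<lambda>i. J i \<omega>)) / real (card ?I)" .
    have "expectation (\<lambda>\<omega>. mu CARD('n) q / 2 * N (X (\<lambda>i. J i \<omega>) k)) \<le> expectation (\<lambda>\<omega>. \<Sum>A\<in>?I. H A (\<lambda>i. J i \<omega>))"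
    proof (rule integral_mono_AE)
      show "AE \<omega> in M. mu CARD('n) q / 2 * N (X (\<lambda>i. J i \<omega>) k) \<le> (\<Sum>A\<in>?I. H A (\<lambda>i. J i \<omega>))"
        using feas
      proof eventually_elim
        case (elim \<omega>)
        then show ?case
          unfolding N_def H_def by (intro sum_block_decrease[OF q_ge q_less diff lip]) blast
      qed
    qed (auto intro: int H_int)
    then have "mu CARD('n) q / 2 * E k \<le> expectation (\<lambda>\<omega>. \<Sum>A\<in>?I. H A (\<lambda>i. J i \<omega>))"
      by (simp add: E_def)
    then have "mu CARD('n) q / 2 * E k / real (card ?I) \<le> F k - F (Suc k)"
      unfolding F_diff by (intro divide_right_mono) auto
    also have "mu CARD('n) q / 2 * E k / real (card ?I) = mu CARD('n) q / real (card ?I) / 2 * E k"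
      by simp
    also have "\<dots> = r * E k"
      using q_ge q_less by (subst mu_over_card_index_sets) (auto simp: r_def)
    finally show ?thesis .
  qed
  have "optimal_value f ?P \<le> F (Suc m)"
  proof -
    have "expectation (\<lambda>_. optimal_value f ?P) \<le> F (Suc m)"
      unfolding F_def
    proof (rule integral_mono_AE)
      show "AE \<omega> in M. optimal_value f ?P \<le> f (X (\<lambda>i. J i \<omega>) (Suc m))"
        using feas by eventually_elim (blast intro: optimal_value_le[OF diff])
    qed (auto intro: int)
    then show ?thesis by (simp add: prob_space)
  qed
  moreover have "F 0 = f x0"
    by (simp add: F_def X_def prob_space)
  moreover have "(\<Sum>k\<le>m. F k - F (Suc k)) = F 0 - F (Suc m)"
    by (rule sum_telescope)
  moreover have "(\<Sum>k\<le>m. r * E k) \<le> (\<Sum>k\<le>m. F k - F (Suc k))"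
    by (intro sum_mono step)
  ultimately have total: "r * (\<Sum>k\<le>m. E k) \<le> f x0 - optimal_value f ?P"
    by (simp add: sum_distrib_left)
  have "(\<Sum>k\<le>m. MIN k\<in>{0..m}. E k) \<le> (\<Sum>k\<le>m. E k)"
    by (intro sum_mono Min_le) auto
  then have "r * ((real m + 1) * (MIN k\<in>{0..m}. E k)) \<le> r * (\<Sum>k\<le>m. E k)"
    using r by (intro mult_left_mono) (auto simp: algebra_simps)
  with total have "r * (real m + 1) * (MIN k\<in>{0..m}. E k) \<le> f x0 - optimal_value f ?P"
    by (simp add: mult.assoc)
  then have "(MIN k\<in>{0..m}. E k) \<le> (f x0 - optimal_value f ?P) / (r * (real m + 1))"
    using r by (subst pos_le_divide_eq) (auto simp: mult.commute)
  also have "\<dots> = 2 * real CARD('n) * (f x0 - optimal_value f ?P) / (real q * (real m + 1))"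
    by (simp add: r_def field_simps)
  finally show "(MIN k\<in>{0..m}. \<integral>\<omega>. (stationarity f a e g q (Gamma_vec q L)
                              (rccd f L a e g x0 (\<lambda>i. J i \<omega>) k))\<^sup>2 \<partial>M)
      \<le> 2 * real CARD('n) * (f x0 - optimal_value f ?P) / (real q * (real m + 1))"
    by (simp only: E_def N_def X_def)
qed

end
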